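(* Let $1\le m<n$, $M\in\mathbf{Gl}_n(\mathbb{R})$, $B\in\mathbb{R}^{n\times m}$, $H\in\mathbb{R}^{m\times n}$ with $\Gamma:=HM^{-1}B\in\mathbf{Gl}_m(\mathbb{R})$, and let $K,D\in C(\mathbb{R}^n\to\mathbb{R}^n)$, $C\in C(\mathbb{R}^n\times\mathbb{R}^n\to\mathbb{R}^{n\times n})$. Consider the control system $$\dot x_1(t)=x_2(t),\quad \dot x_2(t)=M^{-1}\big(-K(x_1(t))-D(x_2(t))-C(x_1(t),x_2(t))x_2(t)\big)+M^{-1}Bu(t),\quad y(t)=Hx_1(t).$$ Let $V,\Theta,\mathcal{M},\tau$ and $\mathcal{F}$ (depending on $\lambda$) be as defined in the context. Assume that there are $z_1^+,z_2^+>0$, functions $g_1,g_2,g_3,g_4,a_3,a_4,b_3,b_4\in C(\mathbb{R}^n\to\mathbb{R}_{\ge0})$ with $a_3\le b_3$ and $a_4\le b_4$ pointwise, and constants $\kappa,\delta,d>0$ such that, with $Z_i:=\{z\in\mathbb{R}^{n-m}\mid\|z\|>z_i^+\}$, $i=1,2$, for all $z_1\in Z_1$, $z_2\in Z_2$ and all $v,w\in\mathbb{R}^n$: (a) there exists a radially unbounded $V_K\in C^1(Z_1\to\mathbb{R})$ such that $V_K'(z_1)=(\Theta K(Vz_1))^\top$; (b) $\|K(Vz_1)-K(Vz_1+w)\|\le g_1(w)$; (c) $z_1^\top\Theta K(Vz_1)\ge\kappa\|z_1\|^2$; (d) $\|D(Vz_2)-D(Vz_2+w)\|\le g_2(w)$;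 (e) $z_2^\top\Theta D(Vz_2)\ge\delta\|z_2\|^2$; (f) $\|D(Vz_2)\|\le d\|z_2\|$; (g) $\|(C(Vz_1,w)-C(Vz_1+v,w))w\|\le g_3(v)a_3(w)$; (h) $z_1^\top\Theta C(Vz_1,w)w\ge\|z_1\|^2b_3(w)$; (i) $\|(C(v,Vz_2)-C(v,Vz_2+w))(Vz_2+w)\|\le g_4(w)a_4(v)\|z_2\|$; (j) $z_2^\top\Theta C(v,Vz_2)Vz_2\ge b_4(v)\|z_2\|\|Vz_2\|^2$; (k) $\|C(v,Vz_2)w\|\le a_4(v)\|z_2\|\|w\|$. Fix $r_1,r_2\ge0$, $0<\lambda<2\kappa/\tau^2$ and $0<q<2\delta/(d^2+2\lambda)$. Then the internal dynamics $$\dot\eta(t)=\mathcal{F}(\eta_1(t),\eta_2(t),y(t),\dot y(t)),\qquad \eta(0)=\eta^0,$$ of the control system are bounded-input, bounded-output stable, with $(y,\dot y)$ as the input and $\eta=(\eta_1,\eta_2)$ as the output.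
   Context: $\|\cdot\|$ is the Euclidean norm for vectors and the spectral norm for matrices; $\|f\|_\infty:=\sup_t\|f(t)\|$; $\mathbf{Gl}_k(\mathbb{R})$ is the group of invertible real $k\times k$ matrices. A function $g$ is radially unbounded if $g(x)\to\infty$ as $\|x\|\to\infty$ in its domain. Definitions: $V\in\mathbb{R}^{n\times(n-m)}$ has orthonormal columns with $\operatorname{im}V=\ker H$; $V^\dagger=(V^\top V)^{-1}V^\top$; $\phi_2:=V^\dagger(I_n-M^{-1}B\Gamma^{-1}H)$; $\mathcal{M}:=M^{-1}B\Gamma^{-1}$; $\Theta:=\phi_2M^{-1}$; $\tau:=\|\Theta\|$. The internal state is $\eta_1=\lambda\phi_2x_1$, $\eta_2=\phi_2x_2$, and $\mathcal{F}:\mathbb{R}^{2(n-m)}\times\mathbb{R}^{2m}\to\mathbb{R}^{2(n-m)}$ is $$\mathcal{F}(z_1,z_2,v_1,v_2)=\begin{pmatrix}\lambda z_2\\ \Theta\big(-K(p)-D(s)-C(p,s)\,s\big)\end{pmatrix},\quad p:=\mathcal{M}v_1+\lambda^{-1}Vz_1,\ s:=\mathcal{M}v_2+Vz_2.$$ Bounded-input, bounded-output stability: a control system $\dot x(t)=f(x(t),u(t))$, $x(0)=x^0$, with input $u\in\mathcal{L}^\infty$ and output $z(t)=h(x(t))$ is called bounded-input, bounded-output stable if there exist $C_1,C_2\ge0$ such that $\|u\|_\infty\le C_1$ implies $\|z\|_\infty\le C_2$ (for the global solutions $x:\mathbb{R}_{\ge0}\to\mathbb{R}^k$ of class $C^1$).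 For the internal dynamics the role of the input is played by $(y,\dot y)$ and the output is $z(t)=\eta(t)$. *)

theory Defs
  imports "HOL-Analysis.Analysis"
begin

section \<open>Control systems and bounded-input, bounded-output stability\<close>

text \<open>Signals live on \<open>[0,\<infinity>)\<close> and are represented by total functions on \<open>real\<close> of which only
  the values at \<open>t \<ge> 0\<close> matter. The norm is the pointwise supremum (not the essential one); it
  takes values in \<open>ereal\<close>, so that it is \<open>\<infinity>\<close> for unbounded signals.\<close>

definition sup_norm :: "(real \<Rightarrow> 'a::real_normed_vector) \<Rightarrow> ereal" where
  "sup_norm f = (SUP t\<in>{0..}. ereal (norm (f t)))"

definition L_infty :: "(real \<Rightarrow> 'a::real_normed_vector) set" where
  "L_infty = {u. u \<in> borel_measurable (lebesgue_on {0..}) \<and> sup_norm u < \<infinity>}"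

text \<open>Global solutions of class \<open>C\<^sup>1\<close> of \<open>x'(t) = f(x(t), u(t))\<close>, \<open>x(0) = x0\<close>; the derivative at
  \<open>t = 0\<close> is one-sided.\<close>

definition global_solution ::
    "('x::real_normed_vector \<Rightarrow> 'u \<Rightarrow> 'x) \<Rightarrow> 'x \<Rightarrow> (real \<Rightarrow> 'u) \<Rightarrow> (real \<Rightarrow> 'x) \<Rightarrow> bool" where
  "global_solution f x0 u x \<longleftrightarrow>
     x 0 = x0 \<and>
     (\<exists>x'. continuous_on {0..} x' \<and>
        (\<forall>t\<ge>0. (x has_vector_derivative x' t) (at t within {0..}) \<and> x' t = f (x t) (u t)))"

text \<open>\<open>U\<close> is the class of admissible inputs, \<open>h\<close> the output map. The initial value is part of the
  system, so \<open>C1\<close> and \<open>C2\<close> may depend on it.\<close>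

definition bibo_stable ::
    "(real \<Rightarrow> 'u::real_normed_vector) set \<Rightarrow> ('x::real_normed_vector \<Rightarrow> 'u \<Rightarrow> 'x) \<Rightarrow>
     ('x \<Rightarrow> 'z::real_normed_vector) \<Rightarrow> 'x \<Rightarrow> bool" where
  "bibo_stable U f h x0 \<longleftrightarrow>
     (\<exists>C1\<ge>0. \<exists>C2\<ge>0. \<forall>u\<in>U. \<forall>x.
        sup_norm u \<le> ereal C1 \<longrightarrow> global_solution f x0 u x \<longrightarrow>
        sup_norm (\<lambda>t. h (x t)) \<le> ereal C2)"

text \<open>Inputs of the form \<open>(y, y')\<close>, with the second component the derivative of the first.\<close>

definition output_signals :: "(real \<Rightarrow> 'a::real_normed_vector \<times> 'a) set" where
  "output_signals =
     {(\<lambda>t. (y t, ydot t)) | y ydot.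
        (\<lambda>t. (y t, ydot t)) \<in> L_infty \<and>
        (\<forall>t\<ge>0. (y has_vector_derivative ydot t) (at t within {0..}))}"


section \<open>The mechanical system and its internal dynamics\<close>

text \<open>Throughout, \<open>CARD('k)\<close> plays the role of \<open>n - m\<close>.\<close>

definition plant_rhs ::
    "real^'n^'n \<Rightarrow> real^'m^'n \<Rightarrow> (real^'n \<Rightarrow> real^'n) \<Rightarrow> (real^'n \<Rightarrow> real^'n) \<Rightarrow>
     (real^'n \<Rightarrow> real^'n \<Rightarrow> real^'n^'n) \<Rightarrow>
     (real^'n) \<times> (real^'n) \<Rightarrow> real^'m \<Rightarrow> (real^'n) \<times> (real^'n)" where
  "plant_rhs M B K D C = (\<lambda>(x1, x2) u.
     (x2, matrix_inv M *v (- K x1 - D x2 - C x1 x2 *v x2) + (matrix_inv M ** B) *v u))"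

definition high_gain :: "real^'n^'n \<Rightarrow> real^'m^'n \<Rightarrow> real^'n^'m \<Rightarrow> real^'m^'m" where
  "high_gain M B H = H ** matrix_inv M ** B"

definition orthonormal_columns :: "real^'k^'n \<Rightarrow> bool" where
  "orthonormal_columns V \<longleftrightarrow> (\<forall>i j. column i V \<bullet> column j V = (if i = j then 1 else 0))"

definition pseudo_inv :: "real^'k^'n \<Rightarrow> real^'n^'k" where
  "pseudo_inv V = matrix_inv (transpose V ** V) ** transpose V"

definition calM :: "real^'n^'n \<Rightarrow> real^'m^'n \<Rightarrow> real^'n^'m \<Rightarrow> real^'m^'n" where
  "calM M B H = matrix_inv M ** B ** matrix_inv (high_gain M B H)"

definition phi2 :: "real^'n^'n \<Rightarrow> real^'m^'n \<Rightarrow> real^'n^'m \<Rightarrow> real^'k^'n \<Rightarrow> real^'n^'k" where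
  "phi2 M B H V =
     pseudo_inv V ** (mat 1 - matrix_inv M ** B ** matrix_inv (high_gain M B H) ** H)"

definition Theta :: "real^'n^'n \<Rightarrow> real^'m^'n \<Rightarrow> real^'n^'m \<Rightarrow> real^'k^'n \<Rightarrow> real^'n^'k" where
  "Theta M B H V = phi2 M B H V ** matrix_inv M"

definition spectral_norm :: "real^'n^'m \<Rightarrow> real" where
  "spectral_norm A = onorm (\<lambda>x. A *v x)"

definition internal_state ::
    "real \<Rightarrow> real^'n^'n \<Rightarrow> real^'m^'n \<Rightarrow> real^'n^'m \<Rightarrow> real^'k^'n \<Rightarrow>
     (real^'n) \<times> (real^'n) \<Rightarrow> (real^'k) \<times> (real^'k)" where
  "internal_state lam M B H V = (\<lambda>(x1, x2). (lam *\<^sub>R (phi2 M B H V *v x1), phi2 M B H V *v x2))"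

text \<open>The map \<open>\<F>\<close>: state \<open>(z1, z2)\<close>, input \<open>(v1, v2)\<close>.\<close>

definition internal_rhs ::
    "real \<Rightarrow> real^'n^'n \<Rightarrow> real^'m^'n \<Rightarrow> real^'n^'m \<Rightarrow> real^'k^'n \<Rightarrow>
     (real^'n \<Rightarrow> real^'n) \<Rightarrow> (real^'n \<Rightarrow> real^'n) \<Rightarrow> (real^'n \<Rightarrow> real^'n \<Rightarrow> real^'n^'n) \<Rightarrow>
     (real^'k) \<times> (real^'k) \<Rightarrow> (real^'m) \<times> (real^'m) \<Rightarrow> (real^'k) \<times> (real^'k)" where
  "internal_rhs lam M B H V K D C = (\<lambda>(z1, z2) (v1, v2).
     let p = calM M B H *v v1 + (1 / lam) *\<^sub>R (V *v z1);
         s = calM M B H *v v2 + V *v z2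
     in (lam *\<^sub>R z2, Theta M B H V *v (- K p - D s - C p s *v s)))"


section \<open>Notions used in the hypotheses\<close>

definition radially_unbounded_on :: "'a::real_normed_vector set \<Rightarrow> ('a \<Rightarrow> real) \<Rightarrow> bool" where
  "radially_unbounded_on S g \<longleftrightarrow> filterlim g at_top (inf at_infinity (principal S))"

text \<open>For open \<open>S\<close>: \<open>f\<close> is of class \<open>C\<^sup>1\<close> on \<open>S\<close> with \<open>f'(x) = (G x)\<^sup>T\<close>.\<close>

definition C1_on_with_gradient :: "'a::euclidean_space set \<Rightarrow> ('a \<Rightarrow> real) \<Rightarrow> ('a \<Rightarrow> 'a) \<Rightarrow> bool" where
  "C1_on_with_gradient S f G \<longleftrightarrow>
     (\<forall>x\<in>S. (f has_derivative (\<lambda>h. G x \<bullet> h)) (at x)) \<and> continuous_on S G"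

definition nonneg_cont :: "('a::topological_space \<Rightarrow> real) \<Rightarrow> bool" where
  "nonneg_cont g \<longleftrightarrow> continuous_on UNIV g \<and> (\<forall>x. 0 \<le> g x)"


section \<open>The internal dynamics are those of the mechanical system\<close>

text \<open>Along every solution of the control system, \<open>\<eta>\<close> solves the internal dynamics driven by
  \<open>y = H x\<^sub>1\<close> and its derivative \<open>H x\<^sub>2\<close>. This justifies the definition of \<^const>\<open>internal_rhs\<close>.\<close>

lemma matrix_inv_both:
  fixes A :: "real^'n^'m"
  assumes "invertible A"
  shows "A ** matrix_inv A = mat 1" "matrix_inv A ** A = mat 1"
  using someI_ex[OF assms[unfolded invertible_def]] by (auto simp: matrix_inv_def)

lemma orthonormal_columns_iff: "orthonormal_columns V \<longleftrightarrow> transpose V ** V = mat 1"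
  by (simp add: orthonormal_columns_def vec_eq_iff matrix_matrix_mult_def inner_vec_def mat_def
      column_def transpose_def)

lemma reconstruct:
  fixes V :: "real^'k^'n" and H :: "real^'n^'m"
  assumes G: "invertible (high_gain M B H)"
    and V: "orthonormal_columns V" "range (\<lambda>z. V *v z) = {x. H *v x = 0}"
  shows "calM M B H *v (H *v x) + V *v (phi2 M B H V *v x) = x"
proof -
  define w where "w = x - calM M B H *v (H *v x)"
  have "H *v (calM M B H *v (H *v x)) = (high_gain M B H ** matrix_inv (high_gain M B H)) *v (H *v x)"
    by (simp add: calM_def high_gain_def matrix_vector_mul_assoc matrix_mul_assoc)
  then have "H *v w = 0"
    by (simp add: w_def matrix_vector_mult_diff_distrib matrix_inv_both[OF G])
  then obtain z where z: "w = V *v z"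
    using V(2) by blast
  have VV: "transpose V ** V = mat 1"
    using V(1) by (simp add: orthonormal_columns_iff)
  have "invertible (mat 1 :: real^'k^'k)"
    unfolding invertible_def by (rule exI[of _ "mat 1"]) simp
  then have "matrix_inv (mat 1 :: real^'k^'k) = mat 1"
    using matrix_inv_both(1)[of "mat 1 :: real^'k^'k"] by simp
  then have "pseudo_inv V ** V = mat 1"
    by (simp add: pseudo_inv_def VV)
  then have pz: "pseudo_inv V *v w = z"
    by (simp add: z matrix_vector_mul_assoc)
  have "phi2 M B H V *v x = pseudo_inv V *v w"
    by (simp add: phi2_def w_def calM_def matrix_vector_mul_assoc[symmetric]
        matrix_vector_mult_diff_rdistrib)
  then have "V *v (phi2 M B H V *v x) = w"
    by (simp only: pz z[symmetric])
  then show ?thesis by (simp add: w_def)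
qed

lemma phi2_input:
  assumes "invertible (high_gain M B H)"
  shows "phi2 M B H V ** (matrix_inv M ** B) = 0"
proof -
  have "(matrix_inv M ** B ** matrix_inv (high_gain M B H) ** H) ** (matrix_inv M ** B)
      = matrix_inv M ** B ** (matrix_inv (high_gain M B H) ** high_gain M B H)"
    by (simp add: high_gain_def matrix_mul_assoc)
  then have *: "(mat 1 - matrix_inv M ** B ** matrix_inv (high_gain M B H) ** H) ** (matrix_inv M ** B) = 0"
    by (simp add: matrix_eq matrix_vector_mul_assoc[symmetric] matrix_vector_mult_diff_rdistrib
        matrix_inv_both[OF assms])
  show ?thesis
    by (simp add: phi2_def matrix_mul_assoc[symmetric] *[unfolded matrix_mul_assoc[symmetric]])
qed

lemma internal_dynamics_of_solution:
  fixes V :: "real^'k^'n" and H :: "real^'n^'m"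
  assumes lam: "lam > 0"
    and G: "invertible (high_gain M B H)"
    and V: "orthonormal_columns V" "range (\<lambda>z. V *v z) = {x. H *v x = 0}"
    and sol: "global_solution (plant_rhs M B K D C) x0 u x"
  shows "global_solution (internal_rhs lam M B H V K D C) (internal_state lam M B H V x0)
           (\<lambda>t. (H *v fst (x t), H *v snd (x t))) (\<lambda>t. internal_state lam M B H V (x t))"
    and "t \<ge> 0 \<Longrightarrow>
      ((\<lambda>t. H *v fst (x t)) has_vector_derivative H *v snd (x t)) (at t within {0..})"
proof -
  obtain x' where x': "x 0 = x0" "continuous_on {0..} x'"
    "\<And>t. t \<ge> 0 \<Longrightarrow> (x has_vector_derivative x' t) (at t within {0..})"
    "\<And>t. t \<ge> 0 \<Longrightarrow> x' t = plant_rhs M B K D C (x t) (u t)"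
    using sol unfolding global_solution_def by blast
  let ?S = "internal_state lam M B H V"
  have bl: "bounded_linear ?S"
  proof -
    have "?S = (\<lambda>q. (lam *\<^sub>R (phi2 M B H V *v fst q), phi2 M B H V *v snd q))"
      by (auto simp: internal_state_def)
    moreover have "bounded_linear (\<lambda>q. (lam *\<^sub>R (phi2 M B H V *v fst q), phi2 M B H V *v snd q))"
      by (intro bounded_linear_Pair bounded_linear_const_scaleR
          bounded_linear_compose[OF matrix_vector_mul_bounded_linear]
          bounded_linear_fst bounded_linear_snd)
    ultimately show ?thesis by simp
  qed
  have rhs: "?S (plant_rhs M B K D C q v)
      = internal_rhs lam M B H V K D C (?S q) (H *v fst q, H *v snd q)" for q v
  proof -
    obtain q1 q2 where q: "q = (q1, q2)" by (cases q)
    have p: "calM M B H *v (H *v q1) + (1 / lam) *\<^sub>R (V *v (lam *\<^sub>R (phi2 M B H V *v q1))) = q1"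
      using reconstruct[OF G V, of q1] lam
      by (simp add: linear_scale[OF matrix_vector_mul_linear])
    have s: "calM M B H *v (H *v q2) + V *v (phi2 M B H V *v q2) = q2"
      using reconstruct[OF G V, of q2] .
    have "phi2 M B H V *v (matrix_inv M *v X + (matrix_inv M ** B) *v v) = Theta M B H V *v X" for X
      using phi2_input[OF G, of V]
      by (simp add: Theta_def matrix_vector_right_distrib matrix_vector_mul_assoc)
    then show ?thesis
      by (simp add: q plant_rhs_def internal_rhs_def internal_state_def p s Let_def)
  qed
  show "global_solution (internal_rhs lam M B H V K D C) (?S x0)
           (\<lambda>t. (H *v fst (x t), H *v snd (x t))) (\<lambda>t. ?S (x t))"
    unfolding global_solution_def
  proof (intro conjI exI[of _ "\<lambda>t. ?S (x' t)"] allI impI)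
    show "continuous_on {0..} (\<lambda>t. ?S (x' t))"
      by (rule bounded_linear.continuous_on[OF bl x'(2)])
    show "((\<lambda>t. ?S (x t)) has_vector_derivative ?S (x' t)) (at t within {0..})" if "0 \<le> t" for t
      by (rule bounded_linear.has_vector_derivative[OF bl x'(3)[OF that]])
    show "?S (x' t) = internal_rhs lam M B H V K D C (?S (x t)) (H *v fst (x t), H *v snd (x t))"
      if "0 \<le> t" for t
      using x'(4)[OF that] rhs by simp
  qed (simp add: x'(1))
  show "((\<lambda>t. H *v fst (x t)) has_vector_derivative H *v snd (x t)) (at t within {0..})"
    if "t \<ge> 0"
  proof -
    have "fst (x' t) = snd (x t)"
      using x'(4)[OF that] by (simp add: plant_rhs_def split: prod.splits)
    moreover have "bounded_linear (\<lambda>q :: (real^'n) \<times> (real^'n). H *v fst q)"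
      by (intro bounded_linear_compose[OF matrix_vector_mul_bounded_linear] bounded_linear_fst)
    ultimately show ?thesis
      using bounded_linear.has_vector_derivative[OF _ x'(3)[OF that], of "\<lambda>q. H *v fst q"] by simp
  qed
qed

end

theory Submission
  imports Defs
begin

text \<open>
  Conditions (h) and (j) carry opposite signs when tested with antiparallel \<open>z\<^sub>1 \<in> Z\<^sub>1\<close> and
  \<open>z\<^sub>2 \<in> Z\<^sub>2\<close>; together with \<open>a\<^sub>i \<le> b\<^sub>i\<close>, (g), (i) and (k) this forces \<open>C(x, s) s = 0\<close> for all
  \<open>x\<close>, \<open>s\<close>, so the velocity-dependent term drops out. By (b) and (d) replacing \<open>p\<close>, \<open>s\<close> by \<open>V z\<^sub>1\<close>, \<open>V z\<^sub>2\<close> costs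
  a bounded error, and a cut-off extends \<open>V\<^sub>K\<close> to a global potential \<open>U\<close>. In the variables
  \<open>z\<^sub>1 = \<eta>\<^sub>1 / \<lambda>\<close>, \<open>z\<^sub>2 = \<eta>\<^sub>2\<close> the internal dynamics become a damped oscillator
  \<open>z\<^sub>1' = z\<^sub>2\<close>, \<open>z\<^sub>2' = e - \<nabla>U(z\<^sub>1) - f(z\<^sub>2)\<close> with bounded forcing \<open>e\<close>. For small \<open>\<epsilon>\<close> the function
  \<open>U(z\<^sub>1) + \<parallel>z\<^sub>2\<parallel>\<^sup>2 / 2 + \<epsilon> z\<^sub>1 \<bullet> z\<^sub>2\<close> is coercive and decreases along solutions outside a ball.
\<close>

section \<open>Compactness bounds and a Lyapunov criterion for ultimate boundedness\<close>

lemma continuous_bounded_on_cball: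
  fixes f :: "'a::{real_normed_vector, heine_borel} \<Rightarrow> 'b::real_normed_vector"
  assumes "continuous_on (cball 0 r) f"
  obtains c where "0 \<le> c" "\<And>x. norm x \<le> r \<Longrightarrow> norm (f x) \<le> c"
proof -
  have "bounded (f ` cball 0 r)"
    using assms by (intro compact_imp_bounded compact_continuous_image) auto
  then obtain c where "c > 0" "\<forall>y\<in>f ` cball 0 r. norm y \<le> c"
    by (auto simp: bounded_pos)
  then show ?thesis by (intro that[of c]) auto
qed

text \<open>A trajectory cannot climb above a level of \<open>W\<close> that dominates
  \<open>W\<close> at the initial point and on the ball of radius \<open>\<rho>\<close>: after the
  last time at or below that level it runs outside the ball, where \<open>W\<close> does not
  increase. Sublevel sets are bounded, so the level turns into a norm bound. \<open>C\<close>
  precedes the quantifier over \<open>x\<close>, because one constant must serve all inputs.\<close>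

lemma lyapunov_bound:
  fixes W :: "'a::{real_normed_vector, heine_borel} \<Rightarrow> real"
  assumes W: "continuous_on UNIV W" and sub: "\<And>c. bounded {x. W x \<le> c}"
  shows "\<exists>C\<ge>0. \<forall>x. x 0 = x0 \<longrightarrow> continuous_on {0..} x \<longrightarrow>
    (\<forall>t\<ge>0. \<rho> < norm (x t) \<longrightarrow>
       (\<exists>D\<le>0. ((\<lambda>t. W (x t)) has_real_derivative D) (at t within {0..}))) \<longrightarrow>
    (\<forall>t\<ge>0. norm (x t) \<le> C)"
proof -
  obtain m where m: "\<And>x. norm x \<le> \<rho> \<Longrightarrow> norm (W x) \<le> m"
    using continuous_bounded_on_cball[of \<rho> W] continuous_on_subset[OF W] by blast
  \<comment> \<open>Two requirements fix this level: \<open>W > c\<close> must force the norm above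
    \<open>\<rho>\<close>, and the trajectory must start at or below it.\<close>
  define c where "c = max m (W x0)"
  obtain C where C: "C > 0" "\<And>x. W x \<le> c \<Longrightarrow> norm x \<le> C"
    using sub[of c] by (auto simp: bounded_pos)
  have "norm (x t1) \<le> C"
    if x0: "x 0 = x0" and cont: "continuous_on {0..} x" and t1: "t1 \<ge> 0"
      and der: "\<And>t. t \<ge> 0 \<Longrightarrow> \<rho> < norm (x t) \<Longrightarrow>
        \<exists>D\<le>0. ((\<lambda>t. W (x t)) has_real_derivative D) (at t within {0..})" for x t1
  proof (rule C(2), rule ccontr)
    assume "\<not> W (x t1) \<le> c"
    then have gt: "W (x t1) > c" by simp
    have contW: "continuous_on {0..} (\<lambda>t. W (x t))"
      using continuous_on_compose2[OF W cont] by auto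
    \<comment> \<open>The supremum of \<open>S\<close> is attained since \<open>S\<close> is closed;
      it is the last time up to \<open>t1\<close> with \<open>W\<close> at most \<open>c\<close>, so
      \<open>W > c\<close> on the rest of the interval.\<close>
    define S where "S = {t\<in>{0..t1}. W (x t) \<le> c}"
    have "closed S"
      unfolding S_def
      by (intro continuous_on_closed_Collect_le continuous_on_subset[OF contW] continuous_intros) auto
    moreover have "0 \<in> S" using x0 t1 by (simp add: S_def c_def)
    moreover have bdd: "bdd_above S" by (auto simp: S_def bdd_above_def)
    ultimately have t0: "Sup S \<in> S" by (intro closed_contains_Sup) auto
    define t0 where "t0 = Sup S"
    have t0: "0 \<le> t0" "t0 \<le> t1" "W (x t0) \<le> c"
      using t0 by (auto simp: t0_def S_def)
    have "t0 \<noteq> t1" using t0 gt by auto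
    with t0 have lt: "t0 < t1" by simp
    have "W (x t0) \<ge> W (x t1)"
    proof (rule DERIV_nonpos_imp_decreasing_open[OF t0(2)])
      fix t assume t: "t0 < t" "t < t1"
      have "t \<notin> S"
        using t cSup_upper[OF _ bdd, of t] by (auto simp: t0_def)
      then have "W (x t) > c" using t t0 by (auto simp: S_def)
      then have "\<rho> < norm (x t)" using m[of "x t"] by (force simp: c_def)
      then obtain D where "D \<le> 0" "((\<lambda>t. W (x t)) has_real_derivative D) (at t within {0..})"
        using der[of t] t t0 by auto
      moreover have "at t within {0..} = at t"
        using t t0 by (intro at_within_interior) simp
      ultimately show "\<exists>y. ((\<lambda>t. W (x t)) has_real_derivative y) (at t) \<and> y \<le> 0" by auto
    qed (use t0 in \<open>auto intro: continuous_on_subset[OF contW]\<close>)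
    with gt t0 show False by simp
  qed
  with C(1) show ?thesis by (intro exI[of _ C]) auto
qed

section \<open>A cut-off function of class C1 and the extension of a potential\<close>

text \<open>The truncated square is the building block of the cut-off below. Only the point 0 needs
  an argument: there the difference quotient is dominated by \<open>\<bar>y\<bar>\<close>.\<close>

lemma sq_max_has_derivative:
  "((\<lambda>x::real. (max 0 x)\<^sup>2) has_real_derivative 2 * max 0 x) (at x)"
proof (cases x "0 :: real" rule: linorder_cases)
  case less
  have "((\<lambda>x::real. 0) has_real_derivative 2 * max 0 x) (at x)"
    using less by simp
  then show ?thesis
    by (rule has_field_derivative_transform_within_open[of _ _ _ "{..<0}"]) (use less in auto)
next
  case equal
  have "((\<lambda>x::real. (max 0 x)\<^sup>2) has_real_derivative 0) (at 0)"
    unfolding has_field_derivative_iff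
  proof (rule Lim_null_comparison)
    show "\<forall>\<^sub>F y in at 0. norm (((max 0 y)\<^sup>2 - (max 0 0)\<^sup>2) / (y - 0 :: real)) \<le> \<bar>y\<bar>"
      by (auto simp: max_def power2_eq_square intro!: always_eventually)
  qed (auto intro!: tendsto_eq_intros)
  then show ?thesis using equal by simp
next
  case greater
  have "((\<lambda>x::real. x\<^sup>2) has_real_derivative 2 * max 0 x) (at x)"
    using greater by (auto intro!: derivative_eq_intros)
  then show ?thesis
    by (rule has_field_derivative_transform_within_open[of _ _ _ "{0<..}"]) (use greater in auto)
qed

text \<open>A quadratic spline with knots 0, 1/2 and 1 that rises from 0 to 1. Its derivative is the
  tent on the unit interval with peak 2 at 1/2, hence of integral 1.\<close>

definition C1_step :: "real \<Rightarrow> real" where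
  "C1_step x = 2 * (max 0 x)\<^sup>2 - 4 * (max 0 (x - 1/2))\<^sup>2 + 2 * (max 0 (x - 1))\<^sup>2"

definition C1_step_deriv :: "real \<Rightarrow> real" where
  "C1_step_deriv x = 4 * max 0 x - 8 * max 0 (x - 1/2) + 4 * max 0 (x - 1)"

lemma C1_step_has_derivative: "(C1_step has_real_derivative C1_step_deriv x) (at x)"
proof -
  have p: "((\<lambda>x. (max 0 (x - a))\<^sup>2) has_real_derivative 2 * max 0 (x - a)) (at x)" for a :: real
  proof -
    have "((\<lambda>x. x - a) has_real_derivative 1) (at x)"
      by (auto intro!: derivative_eq_intros)
    from DERIV_chain2[OF sq_max_has_derivative this] show ?thesis by simp
  qed
  have "(C1_step has_real_derivative
      2 * (2 * max 0 (x - 0)) - 4 * (2 * max 0 (x - 1/2)) + 2 * (2 * max 0 (x - 1))) (at x)"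
    unfolding C1_step_def[abs_def]
    by (intro DERIV_add DERIV_diff DERIV_cmult p p[of 0, simplified diff_zero]) (use p[of 0] in simp)
  then show ?thesis by (simp add: C1_step_deriv_def)
qed

lemma C1_step_simps:
  "x \<le> 0 \<Longrightarrow> C1_step x = 0" "x \<ge> 1 \<Longrightarrow> C1_step x = 1" "x \<ge> 1 \<Longrightarrow> C1_step_deriv x = 0"
  by (auto simp: C1_step_def C1_step_deriv_def max_def power2_eq_square field_simps)

lemma continuous_on_C1_step_deriv: "continuous_on A C1_step_deriv"
  unfolding C1_step_deriv_def[abs_def] by (intro continuous_intros)

text \<open>Multiplying \<open>f\<close> by a radial cut-off that is 0 near the hole and 1 from
  radius \<open>R\<close> on gives a function which continues by 0 into the hole. The gradient is
  changed only inside the ball of radius \<open>R\<close>.\<close>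

lemma C1_extension:
  fixes f :: "'a::euclidean_space \<Rightarrow> real"
  assumes f: "C1_on_with_gradient {z. r < norm z} f g" and r: "0 \<le> r" "r < R"
  obtains U G where "C1_on_with_gradient UNIV U G" "\<And>z. R \<le> norm z \<Longrightarrow> G z = g z"
proof -
  \<comment> \<open>A radius strictly between \<open>r\<close> and \<open>R\<close> makes the
    regions \<open>r < norm z\<close> and \<open>norm z < s\<close> overlap, so that together they
    form an open cover of the space.\<close>
  define s where "s = (r + R) / 2"
  have s: "r < s" "s < R" "s > 0" using r by (auto simp: s_def)
  define L where "L = R\<^sup>2 - s\<^sup>2"
  have L: "L > 0" unfolding L_def using s by (simp add: power_strict_mono)
  \<comment> \<open>An affine function of the squared norm, 0 at radius \<open>s\<close> and 1 at
    radius \<open>R\<close>; unlike the norm, it is differentiable at the origin too.\<close>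
  define x where "x z = (z \<bullet> z - s\<^sup>2) / L" for z :: 'a
  have x_le: "x z \<le> 0" if "norm z \<le> s" for z
    using that L s by (simp add: x_def divide_le_0_iff dot_square_norm power_mono)
  have x_ge: "x z \<ge> 1" if "norm z \<ge> R" for z
    using that L s by (simp add: x_def L_def le_divide_eq dot_square_norm power_mono)
  have contx: "continuous_on A x" for A
    unfolding x_def using L by (intro continuous_intros) auto
  have contp: "continuous_on A (\<lambda>z. C1_step (x z))" for A
  proof -
    have "continuous_on UNIV C1_step"
      using C1_step_has_derivative by (intro continuous_at_imp_continuous_on) (auto intro: DERIV_isCont)
    then show ?thesis using contx by (rule continuous_on_compose2) auto
  qed
  have contp': "continuous_on A (\<lambda>z. C1_step_deriv (x z))" for A
    using continuous_on_C1_step_deriv[of UNIV] contx by (rule continuous_on_compose2) auto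
  define U where "U z = (if norm z < s then 0 else C1_step (x z) * f z)" for z
  define G where "G z = (if norm z < s then 0 else
      C1_step (x z) *\<^sub>R g z + (2 * C1_step_deriv (x z) * f z / L) *\<^sub>R z)" for z
  have df: "(f has_derivative (\<lambda>h. g z \<bullet> h)) (at z)" if "r < norm z" for z
    using f that by (auto simp: C1_on_with_gradient_def)
  have contg: "continuous_on {z. r < norm z} g"
    using f by (auto simp: C1_on_with_gradient_def)
  have contf: "continuous_on {z. r < norm z} f"
    by (intro continuous_at_imp_continuous_on) (auto intro: has_derivative_continuous df)
  have op: "open {z :: 'a. r < norm z}" "open {z :: 'a. norm z < s}"
    by (intro open_Collect_less continuous_intros)+
  have p0: "C1_step_deriv (x z) = 0" if "norm z < s" for z
  proof -
    have "x z \<in> {..<0}"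
      using that L s by (simp add: x_def divide_less_0_iff dot_square_norm power_strict_mono)
    then have "(C1_step has_real_derivative 0) (at (x z))"
      by (rule has_field_derivative_transform_within_open[OF DERIV_const open_lessThan])
        (simp add: C1_step_simps(1))
    then show ?thesis by (rule DERIV_unique[OF C1_step_has_derivative])
  qed
  \<comment> \<open>The case distinction disappears: the cut-off and its derivative vanish for
    \<open>norm z < s\<close>, whatever values \<open>f\<close> and \<open>g\<close> have
    there.\<close>
  have U_eq: "U z = C1_step (x z) * f z" and
    G_eq: "G z = C1_step (x z) *\<^sub>R g z + (2 * C1_step_deriv (x z) * f z / L) *\<^sub>R z" for z
    using C1_step_simps(1)[OF x_le, of z] p0[of z] by (auto simp: U_def G_def)
  have "(U has_derivative (\<lambda>h. G z \<bullet> h)) (at z)" for z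
  proof (cases "norm z < s")
    case True
    have "((\<lambda>_. 0) has_derivative (\<lambda>h. G z \<bullet> h)) (at z)"
      using True by (simp add: G_def)
    then show ?thesis
      by (rule has_derivative_transform_within_open[OF _ op(2)]) (use True in \<open>auto simp: U_def\<close>)
  next
    case False
    then have z: "r < norm z" using s by simp
    have dx: "(x has_derivative (\<lambda>h. 2 * (z \<bullet> h) / L)) (at z)"
      unfolding x_def using L
      by (auto intro!: derivative_eq_intros simp: inner_commute)
    have "((\<lambda>z. C1_step (x z)) has_derivative (\<lambda>h. 2 * (z \<bullet> h) / L * C1_step_deriv (x z))) (at z)"
      using has_derivative_compose[OF dx C1_step_has_derivative[unfolded has_field_derivative_def]]
      by (simp add: mult.commute)
    from has_derivative_mult[OF this df[OF z]] show ?thesis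
      unfolding U_eq[abs_def]
      by (rule has_derivative_eq_rhs) (auto simp: G_eq inner_add_left fun_eq_iff)
  qed
  moreover have "continuous_on UNIV G"
  proof -
    have "continuous_on ({z. r < norm z} \<union> {z. norm z < s}) G"
    proof (rule continuous_on_open_Un[OF op])
      show "continuous_on {z. r < norm z} G"
        unfolding G_eq[abs_def] using L
        by (intro continuous_intros contp contp' contf contg) auto
      have "continuous_on {z. norm z < s} (\<lambda>z. 0 :: 'a)" by simp
      then show "continuous_on {z. norm z < s} G"
        by (rule continuous_on_eq) (simp add: G_def)
    qed
    moreover have "{z :: 'a. r < norm z} \<union> {z. norm z < s} = UNIV" using s by auto
    ultimately show ?thesis by simp
  qed
  ultimately have "C1_on_with_gradient UNIV U G" by (simp add: C1_on_with_gradient_def)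
  moreover have "G z = g z" if "R \<le> norm z" for z
    using C1_step_simps(2,3)[OF x_ge[OF that]] by (simp add: G_eq)
  ultimately show ?thesis using that by blast
qed

section \<open>Damped oscillators with bounded forcing\<close>

text \<open>Outside the ball of radius \<open>R\<close>, the function
  \<open>U z - \<kappa> / 2 * (norm z)\<^sup>2\<close> is nondecreasing along rays from the origin,
  because its radial derivative is controlled by \<open>z \<bullet> G z\<close>. Its values there
  are thus bounded below by those on the sphere, which are bounded by compactness.\<close>

lemma potential_lower_bound:
  fixes U :: "'a::euclidean_space \<Rightarrow> real"
  assumes U: "C1_on_with_gradient UNIV U G" and R: "R > 0"
    and G: "\<And>z. R \<le> norm z \<Longrightarrow> \<kappa> * (norm z)\<^sup>2 \<le> z \<bullet> G z"
  obtains c where "\<And>z. \<kappa> / 2 * (norm z)\<^sup>2 - c \<le> U z"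
proof -
  have dU: "(U has_derivative (\<lambda>h. G z \<bullet> h)) (at z)" for z
    using U by (auto simp: C1_on_with_gradient_def)
  have "continuous_on (cball 0 R) (\<lambda>z. U z - \<kappa> / 2 * (norm z)\<^sup>2)"
    by (intro continuous_intros continuous_at_imp_continuous_on)
      (auto intro: has_derivative_continuous dU)
  then obtain c where c: "\<And>z. norm z \<le> R \<Longrightarrow> \<bar>U z - \<kappa> / 2 * (norm z)\<^sup>2\<bar> \<le> c"
    by (rule continuous_bounded_on_cball) auto
  have "\<kappa> / 2 * (norm z)\<^sup>2 - c \<le> U z" for z
  proof (cases "norm z \<le> R")
    case True
    then show ?thesis using c[of z] by (auto simp: abs_le_iff)
  next
    case False
    \<comment> \<open>The parameter at which the ray through \<open>z\<close> meets the sphere of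
      radius \<open>R\<close>.\<close>
    define t0 where "t0 = R / norm z"
    have "norm z > 0" using False R by linarith
    have t0: "0 < t0" "t0 \<le> 1" using False R by (auto simp: t0_def divide_le_eq intro!: divide_pos_pos)
    define F where "F t = U (t *\<^sub>R z) - \<kappa> / 2 * (norm (t *\<^sub>R z))\<^sup>2" for t
    have F_eq: "F = (\<lambda>t. U (t *\<^sub>R z) - \<kappa> / 2 * (norm z)\<^sup>2 * t\<^sup>2)"
      by (auto simp: F_def power_mult_distrib)
    have "F t0 \<le> F 1"
    proof (rule DERIV_nonneg_imp_nondecreasing[OF t0(2)])
      fix t assume t: "t0 \<le> t" "t \<le> 1"
      then have tp: "t > 0" using t0 by simp
      have "((\<lambda>t. U (t *\<^sub>R z)) has_derivative (\<lambda>h. G (t *\<^sub>R z) \<bullet> (h *\<^sub>R z))) (at t)"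
        by (rule has_derivative_compose[OF _ dU]) (auto intro!: derivative_eq_intros)
      then have "((\<lambda>t. U (t *\<^sub>R z)) has_real_derivative G (t *\<^sub>R z) \<bullet> z) (at t)"
        by (simp add: has_field_derivative_def mult.commute[of _ "_ \<bullet> _"])
      then have "(F has_real_derivative G (t *\<^sub>R z) \<bullet> z - \<kappa> * t * (norm z)\<^sup>2) (at t)"
        unfolding F_eq by (auto intro!: derivative_eq_intros)
      moreover have "G (t *\<^sub>R z) \<bullet> z - \<kappa> * t * (norm z)\<^sup>2 \<ge> 0"
      proof -
        have "R \<le> norm (t *\<^sub>R z)"
          using t tp \<open>norm z > 0\<close> by (simp add: t0_def pos_divide_le_eq)
        \<comment> \<open>The hypothesis pairs the gradient with \<open>t *\<^sub>R z\<close>, so it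
          yields the wanted inequality multiplied by \<open>t > 0\<close>.\<close>
        from G[OF this] have "t * (\<kappa> * t * (norm z)\<^sup>2) \<le> t * (G (t *\<^sub>R z) \<bullet> z)"
          by (simp add: power_mult_distrib inner_commute) (simp add: power2_eq_square algebra_simps)
        then show ?thesis using tp by simp
      qed
      ultimately show "\<exists>y. (F has_real_derivative y) (at t) \<and> 0 \<le> y" by blast
    qed
    moreover have "norm (t0 *\<^sub>R z) \<le> R" using False R by (auto simp: t0_def)
    from c[OF this] have "F t0 \<ge> -c" unfolding F_def by (auto simp: abs_le_iff)
    ultimately show ?thesis by (simp add: F_def)
  qed
  then show ?thesis using that by blast
qed

text \<open>The energy alone dissipates only in \<open>z2\<close>. The cross term
  \<open>\<epsilon> * (z1 \<bullet> z2)\<close> contributes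
  \<open>- \<epsilon> * (z1 \<bullet> G z1)\<close> to the derivative and so supplies decay in
  \<open>z1\<close>; for small \<open>\<epsilon>\<close> its other contributions are absorbed by the
  damping and by part of this decay. The bound depends on \<open>e\<close> only through
  \<open>E\<close>.\<close>

lemma damped_oscillator_bounded:
  fixes U :: "'a::euclidean_space \<Rightarrow> real"
  assumes U: "C1_on_with_gradient UNIV U G" and pos: "\<kappa> > 0" "\<delta> > 0" "R > 0" "d \<ge> 0" "E \<ge> 0"
    and G: "\<And>z. R \<le> norm z \<Longrightarrow> \<kappa> * (norm z)\<^sup>2 \<le> z \<bullet> G z"
    and f_cont: "continuous_on UNIV f"
    and f1: "\<And>z. R \<le> norm z \<Longrightarrow> \<delta> * (norm z)\<^sup>2 \<le> z \<bullet> f z"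
    and f2: "\<And>z. R \<le> norm z \<Longrightarrow> norm (f z) \<le> d * norm z"
  shows "\<exists>Cb\<ge>0. \<forall>z1 z2 e. z1 0 = a \<longrightarrow> z2 0 = b \<longrightarrow>
    (\<forall>t\<ge>0. (z1 has_vector_derivative z2 t) (at t within {0..}) \<and>
       (z2 has_vector_derivative e t - G (z1 t) - f (z2 t)) (at t within {0..}) \<and>
       norm (e t) \<le> E) \<longrightarrow>
    (\<forall>t\<ge>0. norm (z1 t, z2 t) \<le> Cb)"
proof -
  have dU: "(U has_derivative (\<lambda>h. G z \<bullet> h)) (at z)" for z
    using U by (auto simp: C1_on_with_gradient_def)
  have G_cont: "continuous_on A G" for A
    using U by (auto simp: C1_on_with_gradient_def intro: continuous_on_subset)
  have U_cont: "continuous_on A U" for A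
    by (intro continuous_at_imp_continuous_on) (auto intro: has_derivative_continuous dU)
  have f_cont: "continuous_on A f" for A
    using f_cont by (rule continuous_on_subset) simp
  obtain cU where cU: "\<And>z. \<kappa> / 2 * (norm z)\<^sup>2 - cU \<le> U z"
    using potential_lower_bound[OF U pos(3) G] by blast
  obtain c1 where c1: "c1 \<ge> 0" "\<And>z. norm z \<le> R \<Longrightarrow> norm (\<kappa> * (norm z)\<^sup>2 - z \<bullet> G z) \<le> c1"
    by (rule continuous_bounded_on_cball[of R "\<lambda>z. \<kappa> * (norm z)\<^sup>2 - z \<bullet> G z"])
      (auto intro!: continuous_intros G_cont)
  obtain c2 where c2: "c2 \<ge> 0" "\<And>z. norm z \<le> R \<Longrightarrow> norm (\<delta> * (norm z)\<^sup>2 - z \<bullet> f z) \<le> c2"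
    by (rule continuous_bounded_on_cball[of R "\<lambda>z. \<delta> * (norm z)\<^sup>2 - z \<bullet> f z"])
      (auto intro!: continuous_intros f_cont)
  obtain c3 where c3: "c3 \<ge> 0" "\<And>z. norm z \<le> R \<Longrightarrow> norm (f z) \<le> c3"
    using continuous_bounded_on_cball[OF f_cont] by blast
  \<comment> \<open>One additive defect makes all three inequalities, assumed only outside the ball,
    valid everywhere.\<close>
  define c where "c = c1 + c2 + c3"
  have c: "c \<ge> 0" "\<And>z. \<kappa> * (norm z)\<^sup>2 - c \<le> z \<bullet> G z"
    "\<And>z. \<delta> * (norm z)\<^sup>2 - c \<le> z \<bullet> f z" "\<And>z. norm (f z) \<le> d * norm z + c"
  proof -
    show "c \<ge> 0" using c1 c2 c3 by (simp add: c_def)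
    fix z :: 'a
    have dn: "0 \<le> d * norm z" using pos by simp
    show "\<kappa> * (norm z)\<^sup>2 - c \<le> z \<bullet> G z"
      using c1(1) c1(2)[of z] c2(1) c3(1) G[of z] unfolding c_def real_norm_def by linarith
    show "\<delta> * (norm z)\<^sup>2 - c \<le> z \<bullet> f z"
      using c2(1) c2(2)[of z] c1(1) c3(1) f1[of z] unfolding c_def real_norm_def by linarith
    show "norm (f z) \<le> d * norm z + c"
      using c3(1) c3(2)[of z] c1(1) c2(1) f2[of z] dn unfolding c_def by linarith
  qed
  \<comment> \<open>The first cap allows \<open>\<epsilon>\<close> to be dropped in front of
    nonnegative terms; with the second it gives
    \<open>\<epsilon>\<^sup>2 \<le> \<kappa> / 4\<close>, needed for coercivity of \<open>W\<close>;
    the third lets half of the damping \<open>\<delta>\<close> pay for \<open>\<epsilon>\<close>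
    times the coefficient of \<open>y\<^sup>2\<close> from the cross term.\<close>
  define \<epsilon> where "\<epsilon> = min 1 (min (\<kappa> / 4) (\<delta> / 2 / (1 + d\<^sup>2 / (2 * \<kappa>))))"
  have q: "1 + d\<^sup>2 / (2 * \<kappa>) > 0" using pos by (intro add_pos_nonneg) auto
  have \<epsilon>: "0 < \<epsilon>" "\<epsilon> \<le> 1" "\<epsilon>\<^sup>2 \<le> \<kappa> / 4" "\<epsilon> * (1 + d\<^sup>2 / (2 * \<kappa>)) \<le> \<delta> / 2"
  proof -
    show pe: "0 < \<epsilon>" using pos q by (simp add: \<epsilon>_def)
    show le1: "\<epsilon> \<le> 1" by (simp add: \<epsilon>_def)
    have "\<epsilon>\<^sup>2 \<le> \<epsilon>" using pe le1 by (simp add: power2_eq_square mult_left_le)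
    also have "\<epsilon> \<le> \<kappa> / 4" unfolding \<epsilon>_def by linarith
    finally show "\<epsilon>\<^sup>2 \<le> \<kappa> / 4" .
    have "\<epsilon> \<le> \<delta> / 2 / (1 + d\<^sup>2 / (2 * \<kappa>))" by (simp add: \<epsilon>_def)
    then show "\<epsilon> * (1 + d\<^sup>2 / (2 * \<kappa>)) \<le> \<delta> / 2"
      using q by (simp only: pos_le_divide_eq)
  qed
  define W where "W p = U (fst p) + 1 / 2 * (snd p \<bullet> snd p) + \<epsilon> * (fst p \<bullet> snd p)" for p :: "'a \<times> 'a"
  \<comment> \<open>The quadratic decay rates that survive in \<open>z1\<close> and
    \<open>z2\<close> after absorbing the mixed terms.\<close>
  define \<mu> where "\<mu> = min (\<epsilon> * \<kappa> / 2) (\<delta> / 2)"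
  have \<mu>: "\<mu> > 0" using pos \<epsilon> by (simp add: \<mu>_def)
  \<comment> \<open>Beyond this radius the quadratic decay outweighs the affine remainder; radius at
    least 1 allows the constant \<open>2 * c\<close> to be bounded by \<open>2 * c\<close> times the
    norm.\<close>
  define \<rho> where "\<rho> = max 1 ((2 * (E + c) + 2 * c) / \<mu>)"
  have norm_pair: "(norm p)\<^sup>2 = (norm (fst p))\<^sup>2 + (norm (snd p))\<^sup>2" for p :: "'a \<times> 'a"
    by (cases p) (simp add: norm_Pair)
  have contW: "continuous_on UNIV W"
    unfolding W_def by (intro continuous_intros continuous_on_compose2[OF U_cont]) auto
  have sub: "bounded {p. W p \<le> l}" for l
  proof -
    \<comment> \<open>The coefficients 1/2 of \<open>\<kappa> * x\<^sup>2\<close> and of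
      \<open>y\<^sup>2\<close> in the lower bound for \<open>W\<close> are halved by paying for the
      cross term.\<close>
    define \<nu> where "\<nu> = min (\<kappa> / 4) (1 / 4)"
    have \<nu>: "\<nu> > 0" using pos by (simp add: \<nu>_def)
    have "norm p \<le> (l + cU) / \<nu> + 1" if "W p \<le> l" for p
    proof -
      define x y where "x = norm (fst p)" and "y = norm (snd p)"
      have "- (x * y) \<le> fst p \<bullet> snd p"
        using Cauchy_Schwarz_ineq2[of "fst p" "snd p"] by (simp add: x_def y_def abs_le_iff)
      then have "\<epsilon> * - (x * y) \<le> \<epsilon> * (fst p \<bullet> snd p)" using \<epsilon> by (intro mult_left_mono) auto
      moreover have "\<epsilon> * (x * y) \<le> \<kappa> / 4 * x\<^sup>2 + y\<^sup>2 / 4"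
      proof -
        have "0 \<le> (\<epsilon> * x - y / 2)\<^sup>2" by simp
        then have "\<epsilon> * (x * y) \<le> \<epsilon>\<^sup>2 * x\<^sup>2 + y\<^sup>2 / 4"
          by (simp add: power2_eq_square algebra_simps)
        moreover have "\<epsilon>\<^sup>2 * x\<^sup>2 \<le> \<kappa> / 4 * x\<^sup>2" using \<epsilon> by (intro mult_right_mono) auto
        ultimately show ?thesis by simp
      qed
      moreover have "W p \<ge> \<kappa> / 2 * x\<^sup>2 - cU + y\<^sup>2 / 2 + \<epsilon> * (fst p \<bullet> snd p)"
        using cU[of "fst p"] by (simp add: W_def x_def y_def dot_square_norm)
      ultimately have "\<kappa> / 4 * x\<^sup>2 + 1 / 4 * y\<^sup>2 \<le> l + cU" using that by simp
      moreover have "\<nu> * x\<^sup>2 \<le> \<kappa> / 4 * x\<^sup>2" "\<nu> * y\<^sup>2 \<le> 1 / 4 * y\<^sup>2"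
        by (intro mult_right_mono; simp add: \<nu>_def)+
      ultimately have "\<nu> * (norm p)\<^sup>2 \<le> l + cU"
        unfolding norm_pair x_def y_def by (simp add: distrib_left)
      then have "(norm p)\<^sup>2 \<le> (l + cU) / \<nu>" using \<nu> by (simp add: pos_le_divide_eq mult.commute)
      moreover have "norm p \<le> (norm p)\<^sup>2 + 1"
        using zero_le_power2[of "norm p - 1/2"] by (simp add: power2_eq_square algebra_simps)
      ultimately show ?thesis by simp
    qed
    then show ?thesis by (auto simp: bounded_iff)
  qed
  obtain Cb where Cb: "Cb \<ge> 0" "\<And>x t. x 0 = (a, b) \<Longrightarrow> continuous_on {0..} x \<Longrightarrow>
      (\<forall>t\<ge>0. \<rho> < norm (x t) \<longrightarrow>
         (\<exists>D\<le>0. ((\<lambda>t. W (x t)) has_real_derivative D) (at t within {0..}))) \<Longrightarrow>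
      t \<ge> 0 \<Longrightarrow> norm (x t) \<le> Cb"
    using lyapunov_bound[OF contW sub, of "(a, b)" \<rho>] by blast
  have "norm (z1 t, z2 t) \<le> Cb" if init: "z1 0 = a" "z2 0 = b" and t: "t \<ge> 0"
    and sol: "\<And>t. t \<ge> 0 \<Longrightarrow> (z1 has_vector_derivative z2 t) (at t within {0..})"
      "\<And>t. t \<ge> 0 \<Longrightarrow>
        (z2 has_vector_derivative e t - G (z1 t) - f (z2 t)) (at t within {0..})"
      "\<And>t. t \<ge> 0 \<Longrightarrow> norm (e t) \<le> E" for z1 z2 e t
  proof (rule Cb(2)[of "\<lambda>t. (z1 t, z2 t)"])
    show "continuous_on {0..} (\<lambda>t. (z1 t, z2 t))"
      using sol(1,2) by (intro continuous_on_Pair)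
        (auto simp: continuous_on_eq_continuous_within intro: has_vector_derivative_continuous)
    show "\<forall>t\<ge>0. \<rho> < norm (z1 t, z2 t) \<longrightarrow>
         (\<exists>D\<le>0. ((\<lambda>t. W (z1 t, z2 t)) has_real_derivative D) (at t within {0..}))"
    proof (intro allI impI)
      fix t :: real assume t: "t \<ge> 0" and big: "\<rho> < norm (z1 t, z2 t)"
      define z2' where "z2' = e t - G (z1 t) - f (z2 t)"
      define D where "D = G (z1 t) \<bullet> z2 t + z2 t \<bullet> z2' + \<epsilon> * (z2 t \<bullet> z2 t + z1 t \<bullet> z2')"
      have d1: "(z1 has_derivative (\<lambda>h. h *\<^sub>R z2 t)) (at t within {0..})"
        and d2: "(z2 has_derivative (\<lambda>h. h *\<^sub>R z2')) (at t within {0..})"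
        using sol(1,2)[OF t] by (simp_all add: has_vector_derivative_def z2'_def)
      have "((\<lambda>t. W (z1 t, z2 t)) has_derivative (\<lambda>h. h * D)) (at t within {0..})"
        unfolding W_def fst_conv snd_conv
        by (rule has_derivative_eq_rhs[OF has_derivative_add[OF
              has_derivative_add[OF has_derivative_compose[OF d1 dU]
                has_derivative_mult_right[OF has_derivative_inner[OF d2 d2]]]
              has_derivative_mult_right[OF has_derivative_inner[OF d1 d2]]]])
          (auto simp: D_def algebra_simps inner_commute fun_eq_iff)
      then have "((\<lambda>t. W (z1 t, z2 t)) has_real_derivative D) (at t within {0..})"
        by (simp add: has_field_derivative_def mult_commute_abs)
      moreover have "D \<le> 0"
      proof -
        define x y n where "x = norm (z1 t)" and "y = norm (z2 t)" and "n = norm (z1 t, z2 t)"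
        have nn: "0 \<le> x" "0 \<le> y" by (simp_all add: x_def y_def)
        have n2: "n\<^sup>2 = x\<^sup>2 + y\<^sup>2" using norm_pair[of "(z1 t, z2 t)"] by (simp add: x_def y_def n_def)
        have xyn: "x \<le> n" "y \<le> n"
          unfolding x_def y_def n_def using norm_fst_le[of "z1 t" "z2 t"] norm_snd_le[of "z2 t" "z1 t"] by auto
        have e: "z \<bullet> e t \<le> norm z * E" for z
          by (rule order_trans[OF norm_cauchy_schwarz mult_left_mono[OF sol(3)[OF t]]]) simp
        have "- (z1 t \<bullet> f (z2 t)) \<le> x * norm (f (z2 t))"
          using Cauchy_Schwarz_ineq2[of "z1 t" "f (z2 t)"] by (simp add: x_def abs_le_iff)
        also have "\<dots> \<le> x * (d * y + c)"
          using c(4)[of "z2 t"] nn by (intro mult_left_mono) (auto simp: y_def)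
        finally have "z1 t \<bullet> z2' \<le> x * E - \<kappa> * x\<^sup>2 + c + x * (d * y + c)"
          using e[of "z1 t"] c(2)[of "z1 t"] by (simp add: z2'_def inner_diff_right x_def)
        then have "\<epsilon> * (z2 t \<bullet> z2 t + z1 t \<bullet> z2')
            \<le> \<epsilon> * (y\<^sup>2 + (x * E - \<kappa> * x\<^sup>2 + c + x * (d * y + c)))"
          using \<epsilon> by (intro mult_left_mono add_mono) (auto simp: y_def dot_square_norm)
        moreover have "G (z1 t) \<bullet> z2 t + z2 t \<bullet> z2' \<le> y * E - \<delta> * y\<^sup>2 + c"
          using e[of "z2 t"] c(3)[of "z2 t"]
          by (simp add: z2'_def inner_diff_right y_def inner_commute[of "G (z1 t)"])
        ultimately have 1: "D \<le> y * E - \<delta> * y\<^sup>2 + c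
            + \<epsilon> * (y\<^sup>2 - \<kappa> * x\<^sup>2 + d * x * y) + \<epsilon> * (x * (E + c) + c)"
          unfolding D_def by (simp add: algebra_simps)
        \<comment> \<open>Young's inequality, weighted so that only half of the decay
          \<open>\<kappa> * x\<^sup>2\<close> is spent.\<close>
        have "d * x * y \<le> \<kappa> / 2 * x\<^sup>2 + d\<^sup>2 / (2 * \<kappa>) * y\<^sup>2"
        proof -
          have "0 \<le> (\<kappa> * x - d * y)\<^sup>2 / (2 * \<kappa>)" using pos by simp
          also have "\<dots> = \<kappa> / 2 * x\<^sup>2 + d\<^sup>2 / (2 * \<kappa>) * y\<^sup>2 - d * x * y"
            using pos by (simp add: power2_eq_square field_simps)
          finally show ?thesis by simp
        qed
        then have "\<epsilon> * (y\<^sup>2 - \<kappa> * x\<^sup>2 + d * x * y)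
            \<le> \<epsilon> * ((1 + d\<^sup>2 / (2 * \<kappa>)) * y\<^sup>2 - \<kappa> / 2 * x\<^sup>2)"
          using \<epsilon> by (intro mult_left_mono) (auto simp: algebra_simps)
        also have "\<dots> = \<epsilon> * (1 + d\<^sup>2 / (2 * \<kappa>)) * y\<^sup>2 - \<epsilon> * \<kappa> / 2 * x\<^sup>2"
          by (simp add: algebra_simps)
        also have "\<dots> \<le> \<delta> / 2 * y\<^sup>2 - \<epsilon> * \<kappa> / 2 * x\<^sup>2"
          using mult_right_mono[OF \<epsilon>(4), of "y\<^sup>2"] by simp
        finally have 2: "\<epsilon> * (y\<^sup>2 - \<kappa> * x\<^sup>2 + d * x * y) \<le> \<delta> / 2 * y\<^sup>2 - \<epsilon> * \<kappa> / 2 * x\<^sup>2" .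
        have 3: "\<epsilon> * (x * (E + c) + c) \<le> x * (E + c) + c"
          using \<epsilon> nn pos c(1) by (intro mult_left_le_one_le) auto
        have 4: "\<mu> * x\<^sup>2 \<le> \<epsilon> * \<kappa> / 2 * x\<^sup>2" "\<mu> * y\<^sup>2 \<le> \<delta> / 2 * y\<^sup>2"
          by (intro mult_right_mono; simp add: \<mu>_def)+
        have 5: "x * (E + c) \<le> n * (E + c)" "y * E \<le> n * (E + c)"
          using xyn nn pos c(1) by (auto intro!: mult_mono)
        have n1: "n > 1" "(2 * (E + c) + 2 * c) / \<mu> < n" using big by (auto simp: n_def \<rho>_def)
        have "D \<le> 2 * (n * (E + c)) + 2 * c - \<mu> * n\<^sup>2"
          using 1 2 3 4 5 by (simp add: n2 distrib_left)
        also have "\<dots> \<le> n * (2 * (E + c) + 2 * c) - n * (\<mu> * n)"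
          using mult_right_mono[of 1 n "2 * c"] n1 c(1) by (simp add: power2_eq_square algebra_simps)
        also have "\<dots> \<le> 0"
        proof -
          have "2 * (E + c) + 2 * c \<le> \<mu> * n"
            using n1(2) \<mu> by (simp add: pos_divide_less_eq mult.commute)
          then show ?thesis using n1 by (simp add: mult_left_mono)
        qed
        finally show ?thesis .
      qed
      ultimately show "\<exists>D\<le>0. ((\<lambda>t. W (z1 t, z2 t)) has_real_derivative D) (at t within {0..})"
        by blast
    qed
  qed (use init t in auto)
  with Cb(1) show ?thesis by blast
qed

section \<open>Bounded perturbations and the vanishing of the velocity-dependent term\<close>

text \<open>For \<open>z\<close> outside the ball of radius \<open>R\<close> the bound is the
  maximum of \<open>g\<close> over small \<open>w\<close>; for \<open>z\<close> inside, the
  difference is continuous on a compact product of balls. Hence \<open>E\<close> is uniform in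
  \<open>z\<close>.\<close>

lemma perturbation_bounded:
  fixes F :: "'b::euclidean_space \<Rightarrow> 'c::real_normed_vector" and L :: "'a::euclidean_space \<Rightarrow> 'b"
    and g :: "'b \<Rightarrow> real"
  assumes F: "continuous_on UNIV F" and L: "continuous_on UNIV L" and g: "continuous_on UNIV g"
    and le: "\<And>z w. R < norm z \<Longrightarrow> norm (F (L z) - F (L z + w)) \<le> g w"
  obtains E where "0 \<le> E" "\<And>z w. norm w \<le> r \<Longrightarrow> norm (F (L z + w) - F (L z)) \<le> E"
proof -
  obtain c1 where c1: "c1 \<ge> 0" "\<And>w. norm w \<le> r \<Longrightarrow> norm (g w) \<le> c1"
    using continuous_bounded_on_cball[of r g] continuous_on_subset[OF g] by blast
  have "continuous_on UNIV (\<lambda>p. F (L (fst p) + snd p) - F (L (fst p)))"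
    by (intro continuous_intros continuous_on_compose2[OF F] continuous_on_compose2[OF L]) auto
  then have "bounded ((\<lambda>p. F (L (fst p) + snd p) - F (L (fst p))) ` (cball 0 R \<times> cball 0 r))"
    by (intro compact_imp_bounded compact_continuous_image compact_Times compact_cball)
      (auto intro: continuous_on_subset)
  then obtain c2 where c2: "c2 > 0" "\<And>z w. norm z \<le> R \<Longrightarrow> norm w \<le> r \<Longrightarrow>
      norm (F (L z + w) - F (L z)) \<le> c2"
    by (auto simp: bounded_pos)
  show ?thesis
  proof (rule that[of "max c1 c2"])
    fix z w assume w: "norm (w :: 'b) \<le> r"
    show "norm (F (L z + w) - F (L z)) \<le> max c1 c2"
    proof (cases "norm z \<le> R")
      case True
      then show ?thesis using c2(2)[OF _ w] by (simp add: le_max_iff_disj)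
    next
      case False
      then show ?thesis using le[of z w] c1(2)[OF w] by (auto simp: norm_minus_commute)
    qed
  qed (use c1 in auto)
qed

lemma norm_orthonormal_columns:
  assumes "orthonormal_columns V"
  shows "norm (V *v z) = norm z"
proof -
  have "(V *v z) \<bullet> (V *v z) = z \<bullet> ((transpose V ** V) *v z)"
    by (simp add: dot_lmul_matrix[symmetric] matrix_vector_mul_assoc[symmetric]
        inner_commute transpose_matrix_vector)
  then show ?thesis
    using assms by (simp add: orthonormal_columns_iff norm_eq_sqrt_inner)
qed

text \<open>A single point \<open>v = V *v z1\<close> is treated first: the sign conflict between
  \<open>h\<close> and \<open>j\<close> gives \<open>b4 v \<le> 0\<close>, so
  \<open>a4 v = 0\<close>, and \<open>k\<close> and \<open>i\<close> then annihilate
  \<open>C v y *v y\<close> for every \<open>y\<close>. With this, \<open>h\<close> at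
  \<open>v\<close> forces \<open>b3 s \<le> 0\<close>, so \<open>a3 s = 0\<close> for every
  \<open>s\<close>, and \<open>g\<close> carries the result from \<open>v\<close> to every
  \<open>x\<close>.\<close>

lemma coriolis_term_vanishes:
  fixes V :: "real^'k^'n" and \<Theta> :: "real^'n^'k" and C :: "real^'n \<Rightarrow> real^'n \<Rightarrow> real^'n^'n"
    and g3 g4 a3 a4 b3 b4 :: "real^'n \<Rightarrow> real"
  assumes V: "orthonormal_columns V" and pos: "z1p > 0" "z2p > 0"
    and nonneg: "\<And>x. 0 \<le> a3 x" "\<And>x. 0 \<le> a4 x"
    and ab_le: "\<And>x. a3 x \<le> b3 x" "\<And>x. a4 x \<le> b4 x"
    and g: "\<And>z1 v w. z1p < norm z1 \<Longrightarrow>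
      norm ((C (V *v z1) w - C (V *v z1 + v) w) *v w) \<le> g3 v * a3 w"
    and h: "\<And>z1 w. z1p < norm z1 \<Longrightarrow> (norm z1)\<^sup>2 * b3 w \<le> z1 \<bullet> (\<Theta> *v (C (V *v z1) w *v w))"
    and i: "\<And>z2 v w. z2p < norm z2 \<Longrightarrow>
      norm ((C v (V *v z2) - C v (V *v z2 + w)) *v (V *v z2 + w)) \<le> g4 w * a4 v * norm z2"
    and j: "\<And>z2 v. z2p < norm z2 \<Longrightarrow>
      b4 v * norm z2 * (norm (V *v z2))\<^sup>2 \<le> z2 \<bullet> (\<Theta> *v (C v (V *v z2) *v (V *v z2)))"
    and k: "\<And>z2 v w. z2p < norm z2 \<Longrightarrow> norm (C v (V *v z2) *v w) \<le> a4 v * norm z2 * norm w"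
  shows "C x s *v s = 0"
proof -
  obtain z1 :: "real^'k" where z1: "norm z1 = z1p + 1"
    using vector_choose_size[of "z1p + 1"] pos by auto
  define v where "v = V *v z1"
  \<comment> \<open>Scaling by \<open>- t\<close> yields a vector opposite to \<open>z1\<close> of
    norm \<open>z2p + norm z1\<close>, hence in the region where \<open>j\<close> applies.\<close>
  define t where "t = z2p / norm z1 + 1"
  have t: "t > 0" using pos by (auto simp: t_def intro!: add_nonneg_pos)
  have z2: "z2p < norm (- t *\<^sub>R z1)" "norm (- t *\<^sub>R z1) > 0"
  proof -
    have "norm (- t *\<^sub>R z1) = z2p + norm z1"
      using t z1 pos by (simp add: t_def distrib_right)
    then show "z2p < norm (- t *\<^sub>R z1)" "norm (- t *\<^sub>R z1) > 0" using z1 pos by simp_all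
  qed
  \<comment> \<open>The same \<open>w\<close> serves as the free velocity in \<open>h\<close> and as
    \<open>V *v z2\<close> in \<open>j\<close>.\<close>
  define w where "w = V *v (- t *\<^sub>R z1)"
  have b3: "0 \<le> b3 y" for y using order_trans[OF nonneg(1) ab_le(1)] .
  have "b4 v * (norm (- t *\<^sub>R z1) * (norm w)\<^sup>2) \<le> - t * (z1 \<bullet> (\<Theta> *v (C v w *v w)))"
    using j[OF z2(1), of v] unfolding w_def[symmetric] inner_scaleR_left mult.assoc .
  also have "\<dots> \<le> 0"
  proof -
    have "0 \<le> (norm z1)\<^sup>2 * b3 w" using b3 by simp
    also have "\<dots> \<le> z1 \<bullet> (\<Theta> *v (C v w *v w))" using h[of z1 w] z1 by (simp add: v_def)
    finally show ?thesis using t by (simp add: mult_nonneg_nonneg)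
  qed
  finally have "b4 v \<le> 0"
  proof -
    have "norm w > 0" unfolding w_def norm_orthonormal_columns[OF V] by (rule z2(2))
    then have "norm (- t *\<^sub>R z1) * (norm w)\<^sup>2 > 0" using z2(2) by (intro mult_pos_pos) auto
    moreover assume "b4 v * (norm (- t *\<^sub>R z1) * (norm w)\<^sup>2) \<le> 0"
    ultimately show ?thesis by (metis mult_pos_pos not_le)
  qed
  then have a4: "a4 v = 0" using nonneg(2)[of v] ab_le(2)[of v] by linarith
  have Cv: "C v y *v y = 0" for y
  proof -
    \<comment> \<open>At the pair \<open>(v, w)\<close> condition \<open>k\<close> kills the whole
      matrix; the shift \<open>y - w\<close> in \<open>i\<close> then moves the second argument from
      \<open>w\<close> to \<open>y\<close>.\<close>
    have "C v w *v y = 0" using k[OF z2(1), of v y] a4 by (simp add: w_def)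
    moreover have "(C v w - C v y) *v y = 0"
      using i[OF z2(1), of v "y - w"] a4 by (simp add: w_def)
    ultimately show ?thesis by (simp add: matrix_vector_mult_diff_rdistrib)
  qed
  have "(norm z1)\<^sup>2 * b3 s \<le> 0" using h[of z1 s] z1 Cv[of s] by (simp add: v_def)
  moreover have "(norm z1)\<^sup>2 > 0" using z1 pos by simp
  ultimately have "b3 s \<le> 0" by (simp add: mult_le_0_iff)
  then have "a3 s = 0" using nonneg(1)[of s] ab_le(1)[of s] by linarith
  then have "(C v s - C x s) *v s = 0"
    using g[of z1 s "x - v"] z1 by (simp add: v_def)
  then show ?thesis using Cv[of s] by (simp add: matrix_vector_mult_diff_rdistrib)
qed

section \<open>Boundedness of the internal dynamics\<close>

lemma sup_norm_leD:
  assumes "sup_norm f \<le> ereal r" "0 \<le> t"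
  shows "norm (f t) \<le> r"
proof -
  have "ereal (norm (f t)) \<le> sup_norm f"
    unfolding sup_norm_def using assms(2) by (intro SUP_upper) auto
  from order_trans[OF this assms(1)] show ?thesis by simp
qed

text \<open>Stability by definition asks for some input radius. The second conjunct concerns the
  prescribed radii \<open>r1\<close> and \<open>r2\<close>, with one \<open>C2\<close> for all
  signals within them.\<close>

theorem theorem4p8:
  fixes M :: "real^'n^'n" and B :: "real^'m^'n" and H :: "real^'n^'m"
    and V :: "real^'k^'n" and \<Theta> :: "real^'n^'k" and \<tau> :: real
    and K D :: "real^'n \<Rightarrow> real^'n" and C :: "real^'n \<Rightarrow> real^'n \<Rightarrow> real^'n^'n"
    and z1p z2p \<kappa> \<delta> d r1 r2 lam q :: real
    and g1 g2 g3 g4 a3 a4 b3 b4 :: "real^'n \<Rightarrow> real"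
    and Z1 Z2 :: "(real^'k) set"
    and \<eta>0 :: "(real^'k) \<times> (real^'k)"
  assumes dims: "CARD('m) < CARD('n)" "CARD('k) = CARD('n) - CARD('m)"
    and M_inv: "invertible M"
    and Gamma_inv: "invertible (high_gain M B H)"
    and K_cont: "continuous_on UNIV K"
    and D_cont: "continuous_on UNIV D"
    and C_cont: "continuous_on UNIV (\<lambda>(x1, x2). C x1 x2)"
    and V_orth: "orthonormal_columns V"
    and V_im: "range (\<lambda>z. V *v z) = {x. H *v x = 0}"
    and Theta_eq: "\<Theta> = Theta M B H V"
    and tau_eq: "\<tau> = spectral_norm \<Theta>"
    and z_pos: "z1p > 0" "z2p > 0"
    and consts_pos: "\<kappa> > 0" "\<delta> > 0" "d > 0"
    and Z1_eq: "Z1 = {z. norm z > z1p}"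
    and Z2_eq: "Z2 = {z. norm z > z2p}"
    and g_cont: "nonneg_cont g1" "nonneg_cont g2" "nonneg_cont g3" "nonneg_cont g4"
    and ab_cont: "nonneg_cont a3" "nonneg_cont a4" "nonneg_cont b3" "nonneg_cont b4"
    and ab_le: "\<forall>x. a3 x \<le> b3 x" "\<forall>x. a4 x \<le> b4 x"
    and a: "\<exists>VK. radially_unbounded_on Z1 VK \<and>
              C1_on_with_gradient Z1 VK (\<lambda>z1. \<Theta> *v K (V *v z1))"
    and b: "\<forall>z1\<in>Z1. \<forall>w. norm (K (V *v z1) - K (V *v z1 + w)) \<le> g1 w"
    and c: "\<forall>z1\<in>Z1. z1 \<bullet> (\<Theta> *v K (V *v z1)) \<ge> \<kappa> * (norm z1)\<^sup>2"
    and d: "\<forall>z2\<in>Z2. \<forall>w. norm (D (V *v z2) - D (V *v z2 + w)) \<le> g2 w"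
    and e: "\<forall>z2\<in>Z2. z2 \<bullet> (\<Theta> *v D (V *v z2)) \<ge> \<delta> * (norm z2)\<^sup>2"
    and f: "\<forall>z2\<in>Z2. norm (D (V *v z2)) \<le> d * norm z2"
    and g: "\<forall>z1\<in>Z1. \<forall>v w.
              norm ((C (V *v z1) w - C (V *v z1 + v) w) *v w) \<le> g3 v * a3 w"
    and h: "\<forall>z1\<in>Z1. \<forall>w. z1 \<bullet> (\<Theta> *v (C (V *v z1) w *v w)) \<ge> (norm z1)\<^sup>2 * b3 w"
    and i: "\<forall>z2\<in>Z2. \<forall>v w.
              norm ((C v (V *v z2) - C v (V *v z2 + w)) *v (V *v z2 + w)) \<le> g4 w * a4 v * norm z2"
    and j: "\<forall>z2\<in>Z2. \<forall>v.
              z2 \<bullet> (\<Theta> *v (C v (V *v z2) *v (V *v z2))) \<ge> b4 v * norm z2 * (norm (V *v z2))\<^sup>2"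
    and k: "\<forall>z2\<in>Z2. \<forall>v w. norm (C v (V *v z2) *v w) \<le> a4 v * norm z2 * norm w"
    and r_nonneg: "r1 \<ge> 0" "r2 \<ge> 0"
    and lam: "0 < lam" "lam < 2 * \<kappa> / \<tau>\<^sup>2"
    and q: "0 < q" "q < 2 * \<delta> / (d\<^sup>2 + 2 * lam)"
  shows "bibo_stable output_signals (internal_rhs lam M B H V K D C) (\<lambda>\<eta>. \<eta>) \<eta>0
       \<and> (\<exists>C2\<ge>0. \<forall>y ydot \<eta>.
            (\<lambda>t. (y t, ydot t)) \<in> output_signals \<longrightarrow>
            sup_norm y \<le> ereal r1 \<longrightarrow> sup_norm ydot \<le> ereal r2 \<longrightarrow>
            global_solution (internal_rhs lam M B H V K D C) \<eta>0 (\<lambda>t. (y t, ydot t)) \<eta> \<longrightarrow>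
            sup_norm \<eta> \<le> ereal C2)"

proof -
  let ?F = "internal_rhs lam M B H V K D C"
  have C0: "C x s *v s = 0" for x s
    by (rule coriolis_term_vanishes[OF V_orth z_pos, of a3 a4 b3 b4 C g3 \<Theta> g4])
      (use ab_cont ab_le g h i j k in \<open>auto simp: nonneg_cont_def Z1_eq Z2_eq\<close>)
  obtain VK where VK: "C1_on_with_gradient {z. z1p < norm z} VK (\<lambda>z. \<Theta> *v K (V *v z))"
    using a by (auto simp: Z1_eq)
  obtain U G where U: "C1_on_with_gradient UNIV U G"
    and G: "\<And>z. z1p + 1 \<le> norm z \<Longrightarrow> G z = \<Theta> *v K (V *v z)"
    using C1_extension[OF VK, of "z1p + 1"] z_pos by auto
  have \<Theta>: "norm (\<Theta> *v x) \<le> \<tau> * norm x" for x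
    unfolding tau_eq spectral_norm_def by (rule onorm) (rule matrix_vector_mul_bounded_linear)
  have \<tau>: "\<tau> \<ge> 0"
    unfolding tau_eq spectral_norm_def by (rule onorm_pos_le) (rule matrix_vector_mul_bounded_linear)
  have lin: "continuous_on S (\<lambda>x. A *v f x)" if "continuous_on S f"
    for A :: "real^'a^'b" and S and f :: "'c::topological_space \<Rightarrow> real^'a"
    by (rule bounded_linear.continuous_on[OF matrix_vector_mul_bounded_linear that])
  have V_cont: "continuous_on UNIV (\<lambda>z. V *v z)" by (intro lin continuous_on_id)
  have pert: "norm (\<Theta> *v x - \<Theta> *v y) \<le> \<tau> * c" if "norm (x - y) \<le> c" for x y c
    using order_trans[OF \<Theta> mult_left_mono[OF that \<tau>]]
    by (simp add: matrix_vector_mult_diff_distrib)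
  \<comment> \<open>This operator norm turns the bounds \<open>r1\<close> and \<open>r2\<close> on
    the signals into bounds on the shifts of \<open>V *v z1\<close> and
    \<open>V *v z2\<close>.\<close>
  define \<mu> where "\<mu> = onorm (\<lambda>v. calM M B H *v v)"
  have \<mu>: "norm (calM M B H *v v) \<le> \<mu> * r" if "norm v \<le> r" for v r
  proof -
    have "norm (calM M B H *v v) \<le> \<mu> * norm v"
      unfolding \<mu>_def by (rule onorm) (rule matrix_vector_mul_bounded_linear)
    also have "\<dots> \<le> \<mu> * r"
      unfolding \<mu>_def
      by (rule mult_left_mono[OF that onorm_pos_le[OF matrix_vector_mul_bounded_linear]])
    finally show ?thesis .
  qed
  have K\<Theta>: "continuous_on UNIV (\<lambda>x. \<Theta> *v K x)" and D\<Theta>: "continuous_on UNIV (\<lambda>x. \<Theta> *v D x)"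
    by (rule lin[OF K_cont], rule lin[OF D_cont])
  have g_cont': "continuous_on UNIV (\<lambda>w. \<tau> * g1 w)" "continuous_on UNIV (\<lambda>w. \<tau> * g2 w)"
    using g_cont by (auto simp: nonneg_cont_def intro: continuous_on_mult_left)
  have bK: "norm (\<Theta> *v K (V *v z) - \<Theta> *v K (V *v z + w)) \<le> \<tau> * g1 w" if "z1p < norm z" for z w
    by (rule pert) (use b that in \<open>simp add: Z1_eq\<close>)
  have bD: "norm (\<Theta> *v D (V *v z) - \<Theta> *v D (V *v z + w)) \<le> \<tau> * g2 w" if "z2p < norm z" for z w
    by (rule pert) (use d that in \<open>simp add: Z2_eq\<close>)
  obtain E1 where E1: "0 \<le> E1" "\<And>z w. norm w \<le> \<mu> * r1 \<Longrightarrow>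
      norm (\<Theta> *v K (V *v z + w) - \<Theta> *v K (V *v z)) \<le> E1"
    by (rule perturbation_bounded[where r = "\<mu> * r1" and R = z1p, OF K\<Theta> V_cont g_cont'(1) bK])
      (assumption, rule that)
  obtain E2 where E2: "0 \<le> E2" "\<And>z w. norm w \<le> \<mu> * r2 \<Longrightarrow>
      norm (\<Theta> *v D (V *v z + w) - \<Theta> *v D (V *v z)) \<le> E2"
    by (rule perturbation_bounded[where r = "\<mu> * r2" and R = z2p, OF D\<Theta> V_cont g_cont'(2) bD])
      (assumption, rule that)
  have KV_cont: "continuous_on S (\<lambda>z. \<Theta> *v K (V *v z))"
    and DV_cont: "continuous_on S (\<lambda>z. \<Theta> *v D (V *v z))" for S
    by (rule continuous_on_compose2[OF K\<Theta> continuous_on_subset[OF V_cont]]; simp)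
      (rule continuous_on_compose2[OF D\<Theta> continuous_on_subset[OF V_cont]]; simp)
  have "continuous_on S G" for S
    using U by (auto simp: C1_on_with_gradient_def intro: continuous_on_subset)
  then have "continuous_on (cball 0 (z1p + 1)) (\<lambda>z. G z - \<Theta> *v K (V *v z))"
    by (intro continuous_on_diff KV_cont)
  then obtain E0 where E0: "0 \<le> E0"
      "\<And>z. norm z \<le> z1p + 1 \<Longrightarrow> norm (G z - \<Theta> *v K (V *v z)) \<le> E0"
    by (rule continuous_bounded_on_cball) auto
  \<comment> \<open>The cut-off alters the gradient only within radius \<open>z1p + 1\<close>, so
    the error is bounded and may be counted as forcing.\<close>
  have E0: "0 \<le> E0" "norm (G z - \<Theta> *v K (V *v z)) \<le> E0" for z
    using E0 G[of z] by (cases "norm z \<le> z1p + 1"; simp)+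
  define E where "E = E0 + E1 + E2"
  define R where "R = max (z1p + 1) (z2p + 1)"
  define f where "f z = \<Theta> *v D (V *v z)" for z
  have fb: "norm (f z) \<le> \<tau> * d' * norm z" if "norm (D (V *v z)) \<le> d' * norm z" for z d'
    using order_trans[OF \<Theta> mult_left_mono[OF that \<tau>]] by (simp add: f_def mult.assoc)
  have "\<exists>Cb\<ge>0. \<forall>z1 z2 e. z1 0 = (1 / lam) *\<^sub>R fst \<eta>0 \<longrightarrow> z2 0 = snd \<eta>0 \<longrightarrow>
    (\<forall>t\<ge>0. (z1 has_vector_derivative z2 t) (at t within {0..}) \<and>
       (z2 has_vector_derivative e t - G (z1 t) - f (z2 t)) (at t within {0..}) \<and>
       norm (e t) \<le> E) \<longrightarrow>
    (\<forall>t\<ge>0. norm (z1 t, z2 t) \<le> Cb)"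
  proof (rule damped_oscillator_bounded[OF U consts_pos(1,2)])
    show "R > 0" "\<tau> * d \<ge> 0" "E \<ge> 0"
      using z_pos \<tau> consts_pos E0(1) E1(1) E2(1) by (simp_all add: R_def E_def)
    show "continuous_on UNIV f" unfolding f_def[abs_def] by (rule DV_cont)
    fix z :: "real^'k" assume "R \<le> norm z"
    then have z: "z \<in> Z1" "z \<in> Z2" "z1p + 1 \<le> norm z"
      by (simp_all add: R_def Z1_eq Z2_eq)
    show "\<kappa> * (norm z)\<^sup>2 \<le> z \<bullet> G z" unfolding G[OF z(3)] using c z(1) ..
    show "\<delta> * (norm z)\<^sup>2 \<le> z \<bullet> f z" unfolding f_def using e z(2) ..
    show "norm (f z) \<le> \<tau> * d * norm z" by (rule fb) (use f z(2) in \<open>rule bspec\<close>)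
  qed
  then obtain Cb where Cb: "Cb \<ge> 0" "\<forall>z1 z2 e. z1 0 = (1 / lam) *\<^sub>R fst \<eta>0 \<longrightarrow> z2 0 = snd \<eta>0 \<longrightarrow>
    (\<forall>t\<ge>0. (z1 has_vector_derivative z2 t) (at t within {0..}) \<and>
       (z2 has_vector_derivative e t - G (z1 t) - f (z2 t)) (at t within {0..}) \<and>
       norm (e t) \<le> E) \<longrightarrow>
    (\<forall>t\<ge>0. norm (z1 t, z2 t) \<le> Cb)"
    by (elim exE conjE) (rule that)
  have bound: "sup_norm \<eta> \<le> ereal ((lam + 1) * Cb)"
    if y: "sup_norm y \<le> ereal r1" "sup_norm ydot \<le> ereal r2"
      and sol: "global_solution ?F \<eta>0 (\<lambda>t. (y t, ydot t)) \<eta>" for y ydot \<eta>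
  proof -
    obtain \<eta>' where \<eta>': "\<eta> 0 = \<eta>0"
      "\<And>t. t \<ge> 0 \<Longrightarrow> (\<eta> has_vector_derivative \<eta>' t) (at t within {0..})"
      "\<And>t. t \<ge> 0 \<Longrightarrow> \<eta>' t = ?F (\<eta> t) (y t, ydot t)"
      using sol unfolding global_solution_def by blast
    \<comment> \<open>Dividing the first component by \<open>lam\<close> removes the factor from its
      equation and gives the oscillator form \<open>z1' = z2\<close>.\<close>
    define z1 z2 where "z1 t = (1 / lam) *\<^sub>R fst (\<eta> t)" and "z2 t = snd (\<eta> t)" for t
    define p s where "p t = V *v z1 t + calM M B H *v y t"
      and "s t = V *v z2 t + calM M B H *v ydot t" for t
    \<comment> \<open>The forcing collects the cut-off error and the shifts inside \<open>K\<close>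
      and \<open>D\<close>, bounded by \<open>E0\<close>, \<open>E1\<close> and \<open>E2\<close> in
      this order.\<close>
    define e where "e t = (G (z1 t) - \<Theta> *v K (V *v z1 t))
        - (\<Theta> *v K (p t) - \<Theta> *v K (V *v z1 t)) - (\<Theta> *v D (s t) - f (z2 t))" for t
    have F: "?F (\<eta> t) (y t, ydot t) = (lam *\<^sub>R z2 t, e t - G (z1 t) - f (z2 t))" for t
    proof -
      have p: "calM M B H *v y t + (1 / lam) *\<^sub>R (V *v fst (\<eta> t)) = p t"
        unfolding p_def z1_def linear_scale[OF matrix_vector_mul_linear] by (rule add.commute)
      have s: "calM M B H *v ydot t + V *v snd (\<eta> t) = s t"
        unfolding s_def z2_def by (rule add.commute)
      have "?F (\<eta> t) (y t, ydot t) = (lam *\<^sub>R z2 t, \<Theta> *v (- K (p t) - D (s t) - 0))"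
        unfolding internal_rhs_def split_beta fst_conv snd_conv Let_def p s C0 Theta_eq z2_def ..
      also have "\<Theta> *v (- K (p t) - D (s t) - 0) = - (\<Theta> *v K (p t)) - \<Theta> *v D (s t)"
        by (simp only: diff_0_right linear_diff[OF matrix_vector_mul_linear]
            linear_neg[OF matrix_vector_mul_linear])
      finally show ?thesis by (simp add: e_def)
    qed
    have e: "norm (e t) \<le> E" if "t \<ge> 0" for t
    proof -
      have "norm (\<Theta> *v K (p t) - \<Theta> *v K (V *v z1 t)) \<le> E1"
        unfolding p_def by (rule E1(2)[OF \<mu>[OF sup_norm_leD[OF y(1) that]]])
      moreover have "norm (\<Theta> *v D (s t) - f (z2 t)) \<le> E2"
        unfolding s_def f_def by (rule E2(2)[OF \<mu>[OF sup_norm_leD[OF y(2) that]]])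
      ultimately show ?thesis
        unfolding e_def E_def
        by (rule order_trans[OF norm_triangle_ineq4 add_mono[OF
              order_trans[OF norm_triangle_ineq4 add_mono[OF E0(2)]]]])
    qed
    have d1: "(z1 has_vector_derivative z2 t) (at t within {0..})" if "t \<ge> 0" for t
    proof -
      have "((\<lambda>t. (1 / lam) *\<^sub>R fst (\<eta> t)) has_vector_derivative (1 / lam) *\<^sub>R fst (\<eta>' t))
          (at t within {0..})"
        by (rule bounded_linear.has_vector_derivative[OF
              bounded_linear_compose[OF bounded_linear_scaleR_right bounded_linear_fst] \<eta>'(2)[OF that]])
      then show ?thesis
        using lam(1) by (simp add: z1_def[abs_def] \<eta>'(3)[OF that] F)
    qed
    have d2: "(z2 has_vector_derivative e t - G (z1 t) - f (z2 t)) (at t within {0..})"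
      if "t \<ge> 0" for t
      using bounded_linear.has_vector_derivative[OF bounded_linear_snd \<eta>'(2)[OF that]]
      by (simp add: z2_def[abs_def] \<eta>'(3)[OF that] F)
    have "norm (\<eta> t) \<le> (lam + 1) * Cb" if "t \<ge> 0" for t
    proof -
      have "norm (z1 t, z2 t) \<le> Cb"
        using Cb(2)[rule_format, of z1 z2 e t] d1 d2 e that by (simp add: z1_def z2_def \<eta>'(1))
      then have z: "norm (z1 t) \<le> Cb" "norm (z2 t) \<le> Cb"
        using norm_fst_le[of "z1 t" "z2 t"] norm_snd_le[of "z2 t" "z1 t"] by auto
      moreover have "\<eta> t = (lam *\<^sub>R z1 t, z2 t)"
        using lam(1) by (simp add: z1_def z2_def)
      then have "norm (\<eta> t) \<le> lam * norm (z1 t) + norm (z2 t)"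
        using norm_Pair_le[of "lam *\<^sub>R z1 t" "z2 t"] lam(1) by simp
      ultimately show ?thesis
        unfolding distrib_right mult_1 using mult_left_mono[OF z(1) less_imp_le[OF lam(1)]] z(2)
        by linarith
    qed
    then show ?thesis unfolding sup_norm_def by (auto intro!: SUP_least)
  qed
  have C2: "(lam + 1) * Cb \<ge> 0" using Cb(1) lam(1) by simp
  have "bibo_stable output_signals ?F (\<lambda>\<eta>. \<eta>) \<eta>0"
    unfolding bibo_stable_def
  proof (intro exI conjI ballI allI impI)
    \<comment> \<open>The input radius is taken to be 0, which lies below \<open>r1\<close> and
      \<open>r2\<close> even if these vanish, so the bound for the prescribed radii applies.\<close>
    fix u \<eta> assume u: "u \<in> output_signals" "sup_norm u \<le> ereal 0" "global_solution ?F \<eta>0 u \<eta>"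
    have u0: "norm (u t) \<le> 0" if "t \<ge> 0" for t
      by (rule sup_norm_leD[OF u(2) that])
    have "sup_norm (\<lambda>t. fst (u t)) \<le> ereal r1" "sup_norm (\<lambda>t. snd (u t)) \<le> ereal r2"
      unfolding sup_norm_def using u0 r_nonneg by (auto intro!: SUP_least)
    then show "sup_norm \<eta> \<le> ereal ((lam + 1) * Cb)"
      by (rule bound) (use u(3) in simp)
  qed (use C2 in auto)
  then show ?thesis using C2 bound by blast
qed

end
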